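(* Let $0\le a<b$ be real numbers, let $\alpha>0$, let $s\in(0,1]$, and let $r$ satisfy $a<r\le b$. Let $f:[a,b]\to\mathbb{R}$ be differentiable on $(a,b)$, with one-sided derivatives $f'(a)$ and $f'(b)$ existing at the endpoints, and suppose $f'\in L_1[a,b]$. If $|f'|$ is $s$-convex in the second sense on $[a,b]$, then $$\left|\frac{f(a)+f(r)}{2}-\frac{\Gamma(\alpha+1)}{2(r-a)^{\alpha}}\left[J_{a^+}^{\alpha}f(r)+J_{r^-}^{\alpha}f(a)\right]\right|\le \frac{r-a}{2}\left[\beta\left(\tfrac12;s+1,\alpha+1\right)-\beta\left(\tfrac12;\alpha+1,s+1\right)+\frac{2^{\alpha+s}-1}{(\alpha+s+1)2^{\alpha+s}}\right]\left[|f'(a)|+|f'(r)|\right].$$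
   Context: A function $g:[a,b]\to\mathbb{R}$ with $[a,b]\subset[0,\infty)$ is $s$-convex in the second sense on $[a,b]$, for a fixed $s\in(0,1]$, if $g(tx+(1-t)y)\le t^s g(x)+(1-t)^s g(y)$ for all $x,y\in[a,b]$ and $t\in[0,1]$. For $\alpha>0$ the Riemann-Liouville fractional integrals are $J_{a^+}^{\alpha}f(x)=\frac{1}{\Gamma(\alpha)}\int_a^x (x-t)^{\alpha-1}f(t)\,dt$ for $x>a$, and $J_{r^-}^{\alpha}f(x)=\frac{1}{\Gamma(\alpha)}\int_x^r (t-x)^{\alpha-1}f(t)\,dt$ for $x<r$, where $\Gamma$ is the Gamma function. $\beta(x;p,q)=\int_0^x u^{p-1}(1-u)^{q-1}\,du$ denotes the incomplete beta function. *)

theory Defs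
  imports "HOL-Analysis.Analysis"
begin

definition s_convex2_on :: "real \<Rightarrow> real \<Rightarrow> real \<Rightarrow> (real \<Rightarrow> real) \<Rightarrow> bool" where
  "s_convex2_on s a b g \<longleftrightarrow>
     0 < s \<and> s \<le> 1 \<and> {a..b} \<subseteq> {0..} \<and>
     (\<forall>x\<in>{a..b}. \<forall>y\<in>{a..b}. \<forall>t\<in>{0..1}.
        g (t * x + (1 - t) * y) \<le> t powr s * g x + (1 - t) powr s * g y)"

text \<open>
  The integrals below are Lebesgue integrals. Where an integrand is singular at an endpoint,
  the convention \<open>0 powr p = 0\<close> only affects a null set.
\<close>

definition RL_left :: "real \<Rightarrow> real \<Rightarrow> (real \<Rightarrow> real) \<Rightarrow> real \<Rightarrow> real" where
  "RL_left a \<alpha> f x =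
     1 / Gamma \<alpha> * (LINT t:{a..x}|lebesgue. (x - t) powr (\<alpha> - 1) * f t)"

definition RL_right :: "real \<Rightarrow> real \<Rightarrow> (real \<Rightarrow> real) \<Rightarrow> real \<Rightarrow> real" where
  "RL_right r \<alpha> f x =
     1 / Gamma \<alpha> * (LINT t:{x..r}|lebesgue. (t - x) powr (\<alpha> - 1) * f t)"

definition incomplete_beta :: "real \<Rightarrow> real \<Rightarrow> real \<Rightarrow> real" where
  "incomplete_beta x p q =
     (LINT u:{0..x}|lebesgue. u powr (p - 1) * (1 - u) powr (q - 1))"

end

theory Submission
  imports Defs
begin

text \<open>
  Put \<open>w x = (x - a) powr \<alpha> - (r - x) powr \<alpha>\<close>. Its derivative on the open interval is \<open>\<alpha>\<close> times
  the sum of the two Riemann-Liouville kernels, and \<open>w r = - w a = (r - a) powr \<alpha>\<close>. Integrating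
  \<open>(w * f)' = w' * f + w * f'\<close> over \<open>{a..r}\<close> therefore turns the difference between the trapezoid
  value \<open>(f a + f r) / 2\<close> and the fractional mean of \<open>f\<close> into the single integral of
  \<open>w * f'\<close>, divided by \<open>2 * (r - a) powr \<alpha>\<close> (\<open>trapezoid_error_RL_integral\<close>).

  The error is then at most the integral of \<open>\<bar>w\<bar> * \<bar>f'\<bar>\<close>, and \<open>s\<close>-convexity bounds \<open>\<bar>f'\<bar>\<close> at a
  point of \<open>{a..r}\<close> by the values at \<open>a\<close> and \<open>r\<close>, weighted by the \<open>s\<close>-th powers of the
  barycentric coordinates (\<open>s_convex2_on_chord_bound\<close>). Since \<open>\<bar>w\<bar>\<close> is symmetric about the
  midpoint, both weights give the same integral, which explains the factor
  \<open>\<bar>f' a\<bar> + \<bar>f' r\<bar>\<close>. Rescaled to the unit interval, that integral is the \<open>s\<close>-th moment of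
  \<open>\<bar>t powr \<alpha> - (1 - t) powr \<alpha>\<bar>\<close>. The sign inside the absolute value changes exactly at \<open>1/2\<close>, so
  the moment splits into two incomplete beta values and an elementary power integral
  (\<open>powr_difference_moment\<close>).
\<close>

section \<open>Affine substitution and integrability of products\<close>

lemma has_integral_rescale_unit:
  fixes a r I :: real and \<phi> :: "real \<Rightarrow> real"
  assumes "(\<phi> has_integral I) {0..1}" and "a < r"
  shows "((\<lambda>x. \<phi> ((x - a) / (r - a))) has_integral (r - a) * I) {a..r}"
proof -
  have eq: "(1 / (r - a)) *\<^sub>R x + (- a / (r - a)) = (x - a) / (r - a)" for x
    by (simp add: diff_divide_distrib)
  have "((\<lambda>x. \<phi> ((1 / (r - a)) *\<^sub>R x + (- a / (r - a)))) has_integral 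
      (I /\<^sub>R (1 / (r - a)) ^ DIM(real)))
     (cbox ((0 - (- a / (r - a))) /\<^sub>R (1 / (r - a))) ((1 - (- a / (r - a))) /\<^sub>R (1 / (r - a))))"
    by (rule has_integral_affinity') (use assms in auto)
  moreover have "(0 - (- a / (r - a))) /\<^sub>R (1 / (r - a)) = a"
    "(1 - (- a / (r - a))) /\<^sub>R (1 / (r - a)) = r"
    using assms(2) by (simp_all add: field_simps)
  ultimately show ?thesis
    unfolding eq by simp
qed

lemma has_integral_reflect_interval:
  fixes \<phi> :: "real \<Rightarrow> real"
  assumes "(\<phi> has_integral I) {u..v}"
  shows "((\<lambda>x. \<phi> (c - x)) has_integral I) {c - v..c - u}"
proof -
  have "((\<lambda>x. \<phi> (- x)) has_integral I) {- v..- u}"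
    using assms by simp
  from has_integral_affinity'[of "\<lambda>x. \<phi> (- x)" I "-v" "-u" 1 "-c"] this
  show ?thesis by (simp add: algebra_simps)
qed

lemma absolutely_integrable_continuous_mult:
  fixes g h :: "real \<Rightarrow> real"
  assumes "continuous_on {a..b} h" and "g absolutely_integrable_on {a..b}"
  shows "(\<lambda>x. h x * g x) absolutely_integrable_on {a..b}"
proof (rule absolutely_integrable_bounded_measurable_product_real)
  show "h \<in> borel_measurable (lebesgue_on {a..b})"
    using assms(1) by (intro continuous_imp_measurable_on_sets_lebesgue) auto
  show "bounded (h ` {a..b})"
    using assms(1) by (intro compact_imp_bounded compact_continuous_image) auto
qed (use assms in auto)

section \<open>The trapezoid error as a single integral\<close>

text \<open>
  For \<open>\<alpha> < 1\<close> the kernels are unbounded at an endpoint; rescaling and reflection reduce both to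
  the known integral of a power above \<open>-1\<close> on the unit interval.
\<close>

lemma absolutely_integrable_powr_kernel:
  fixes a r \<alpha> :: real
  assumes "0 < \<alpha>" and "a < r"
  shows "(\<lambda>x. (x - a) powr (\<alpha> - 1)) absolutely_integrable_on {a..r}"
    and "(\<lambda>x. (r - x) powr (\<alpha> - 1)) absolutely_integrable_on {a..r}"
proof -
  have *: "((\<lambda>t::real. t powr (\<alpha> - 1)) has_integral (1 / \<alpha>)) {0..1}"
    using has_integral_powr_from_0[of "\<alpha> - 1" 1] assms(1) by simp
  have "((\<lambda>x. ((x - a) / (r - a)) powr (\<alpha> - 1)) has_integral (r - a) * (1 / \<alpha>)) {a..r}"
    by (rule has_integral_rescale_unit[OF * assms(2)])
  from has_integral_mult_right[OF this, of "(r - a) powr (\<alpha> - 1)"]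
  have 1: "((\<lambda>x. (x - a) powr (\<alpha> - 1)) has_integral
      ((r - a) powr (\<alpha> - 1) * ((r - a) * (1 / \<alpha>)))) {a..r}"
    by (rule has_integral_eq[rotated]) (use assms in \<open>auto simp: powr_divide\<close>)
  then show "(\<lambda>x. (x - a) powr (\<alpha> - 1)) absolutely_integrable_on {a..r}"
    by (intro nonnegative_absolutely_integrable_1) (auto simp: integrable_on_def)
  from has_integral_reflect_interval[OF 1, of "a + r"]
  show "(\<lambda>x. (r - x) powr (\<alpha> - 1)) absolutely_integrable_on {a..r}"
    by (intro nonnegative_absolutely_integrable_1) (auto simp: integrable_on_def)
qed

text \<open>
  Integration by parts against the difference of powers, whose derivative is the sum of the two
  kernels. The derivative may blow up at both endpoints, so the fundamental theorem is used in
  the form that asks for continuity on the closed interval and differentiability in its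
  interior only. The three parts of the integrand are absolutely integrable separately, hence
  the integral can be split.
\<close>

lemma trapezoid_error_RL_integral:
  fixes a r \<alpha> :: real and f f' :: "real \<Rightarrow> real"
  assumes "0 < \<alpha>" and "a < r"
    and cont: "continuous_on {a..r} f"
    and deriv: "\<And>x. a < x \<Longrightarrow> x < r \<Longrightarrow> (f has_real_derivative f' x) (at x)"
    and f': "f' absolutely_integrable_on {a..r}"
  shows "(f a + f r) / 2 - Gamma (\<alpha> + 1) / (2 * (r - a) powr \<alpha>) *
           (RL_left a \<alpha> f r + RL_right r \<alpha> f a)
       = 1 / (2 * (r - a) powr \<alpha>) *
           integral {a..r} (\<lambda>x. ((x - a) powr \<alpha> - (r - x) powr \<alpha>) * f' x)"
proof -
  define w where "w x = (x - a) powr \<alpha> - (r - x) powr \<alpha>" for x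
  define L where "L x = (r - x) powr (\<alpha> - 1) * f x" for x
  define R where "R x = (x - a) powr (\<alpha> - 1) * f x" for x
  have w_cont: "continuous_on {a..r} w"
    unfolding w_def using assms(1) by (intro continuous_intros continuous_on_powr') auto
  have L: "L absolutely_integrable_on {a..r}" and R: "R absolutely_integrable_on {a..r}"
    unfolding L_def R_def
    using absolutely_integrable_continuous_mult[OF cont absolutely_integrable_powr_kernel(2)[OF assms(1,2)]]
      absolutely_integrable_continuous_mult[OF cont absolutely_integrable_powr_kernel(1)[OF assms(1,2)]]
    by (simp_all only: mult.commute)
  have wf': "(\<lambda>x. w x * f' x) absolutely_integrable_on {a..r}"
    by (rule absolutely_integrable_continuous_mult[OF w_cont f'])
  have "((\<lambda>x. \<alpha> * (L x + R x) + w x * f' x) has_integral w r * f r - w a * f a) {a..r}"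
  proof (rule fundamental_theorem_of_calculus_interior)
    show "continuous_on {a..r} (\<lambda>x. w x * f x)"
      by (intro continuous_intros w_cont cont)
    fix x assume x: "x \<in> {a<..<r}"
    have "((\<lambda>x. w x * f x) has_real_derivative \<alpha> * (L x + R x) + w x * f' x) (at x)"
      unfolding w_def
      by (rule derivative_eq_intros deriv refl | use x in \<open>simp; fail\<close>)+
         (use x in \<open>auto simp: L_def R_def w_def field_simps powr_diff\<close>)
    then show "((\<lambda>x. w x * f x) has_vector_derivative \<alpha> * (L x + R x) + w x * f' x) (at x)"
      by (simp add: has_real_derivative_iff_has_vector_derivative)
  qed (use assms(2) in auto)
  then have "integral {a..r} (\<lambda>x. \<alpha> * (L x + R x) + w x * f' x) = (r - a) powr \<alpha> * (f a + f r)"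
    using assms by (simp add: integral_unique w_def algebra_simps)
  moreover have "integral {a..r} (\<lambda>x. \<alpha> * (L x + R x) + w x * f' x)
      = \<alpha> * (integral {a..r} L + integral {a..r} R) + integral {a..r} (\<lambda>x. w x * f' x)"
    using L R wf' by (simp add: integral_add integrable_add set_lebesgue_integral_eq_integral(1))
  ultimately have parts: "\<alpha> * (integral {a..r} L + integral {a..r} R)
      = (r - a) powr \<alpha> * (f a + f r) - integral {a..r} (\<lambda>x. w x * f' x)"
    by simp
  have "Gamma \<alpha> \<noteq> 0" using Gamma_real_pos[OF assms(1)] by simp
  moreover have "Gamma (\<alpha> + 1) = \<alpha> * Gamma \<alpha>"
    using assms(1) by (intro Gamma_plus1) (auto elim!: nonpos_Ints_cases)
  ultimately have "Gamma (\<alpha> + 1) * (RL_left a \<alpha> f r + RL_right r \<alpha> f a)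
      = \<alpha> * (integral {a..r} L + integral {a..r} R)"
    using assms(1) set_lebesgue_integral_eq_integral(2)[OF L]
      set_lebesgue_integral_eq_integral(2)[OF R]
    by (simp add: RL_left_def RL_right_def L_def R_def distrib_left)
  with parts have "Gamma (\<alpha> + 1) * (RL_left a \<alpha> f r + RL_right r \<alpha> f a)
      = (r - a) powr \<alpha> * (f a + f r) - integral {a..r} (\<lambda>x. w x * f' x)"
    by simp
  moreover have "F / 2 - G / (2 * c) * S = 1 / (2 * c) * J"
    if "G * S = c * F - J" and "c \<noteq> 0" for F G S J c :: real
    using that by (simp add: diff_divide_distrib)
  ultimately show ?thesis
    using assms(2) unfolding w_def by simp
qed

section \<open>Moments of the power difference\<close>

lemma incomplete_beta_has_integral:
  fixes p q x :: real
  assumes "1 < p" and "1 < q" and "x \<le> 1"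
  shows "((\<lambda>u. u powr (p - 1) * (1 - u) powr (q - 1)) has_integral incomplete_beta x p q) {0..x}"
proof -
  have "continuous_on {0..x} (\<lambda>u. u powr (p - 1) * (1 - u) powr (q - 1))"
    using assms by (intro continuous_intros continuous_on_powr') auto
  then have "(\<lambda>u. u powr (p - 1) * (1 - u) powr (q - 1)) absolutely_integrable_on {0..x}"
    by (rule absolutely_integrable_continuous_real)
  from set_lebesgue_integral_eq_integral[OF this] show ?thesis
    by (simp add: incomplete_beta_def has_integral_integral)
qed

text \<open>
  On \<open>{0..1/2}\<close> the integrand is \<open>t powr s * (1 - t) powr \<alpha> - t powr (\<alpha> + s)\<close>, on \<open>{1/2..1}\<close> it is
  the negative of this. The first mixed term is an incomplete beta integral as it stands, the
  second becomes one, with the exponents exchanged, under \<open>t \<mapsto> 1 - t\<close>.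
\<close>

lemma powr_difference_moment:
  fixes \<alpha> s :: real
  assumes "0 < \<alpha>" and "0 < s"
  shows "((\<lambda>t. \<bar>t powr \<alpha> - (1 - t) powr \<alpha>\<bar> * t powr s) has_integral
           (incomplete_beta (1/2) (s + 1) (\<alpha> + 1) - incomplete_beta (1/2) (\<alpha> + 1) (s + 1)
             + (2 powr (\<alpha> + s) - 1) / ((\<alpha> + s + 1) * 2 powr (\<alpha> + s)))) {0..1}"
proof -
  let ?B1 = "incomplete_beta (1/2) (s + 1) (\<alpha> + 1)"
  let ?B2 = "incomplete_beta (1/2) (\<alpha> + 1) (s + 1)"
  let ?P = "\<lambda>c. c powr (\<alpha> + s + 1) / (\<alpha> + s + 1)"
  have B1: "((\<lambda>t. t powr s * (1 - t) powr \<alpha>) has_integral ?B1) {0..1/2}"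
    using incomplete_beta_has_integral[of "s + 1" "\<alpha> + 1" "1/2"] assms by simp
  have "((\<lambda>t. t powr \<alpha> * (1 - t) powr s) has_integral ?B2) {0..1/2}"
    using incomplete_beta_has_integral[of "\<alpha> + 1" "s + 1" "1/2"] assms by simp
  from has_integral_reflect_interval[OF this, of 1]
  have B2: "((\<lambda>t. (1 - t) powr \<alpha> * t powr s) has_integral ?B2) {1/2..1}"
    by simp
  have P: "((\<lambda>t. t powr (\<alpha> + s)) has_integral ?P d - ?P c) {c..d}" if "0 \<le> c" "c \<le> d" for c d :: real
  proof (rule fundamental_theorem_of_calculus_interior)
    show "continuous_on {c..d} ?P"
      using assms that by (intro continuous_intros continuous_on_powr') auto
    fix x assume "x \<in> {c<..<d}"
    then have "x > 0" using that by auto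
    then have "(?P has_real_derivative x powr (\<alpha> + s)) (at x)"
      using assms by (auto intro!: derivative_eq_intros)
    then show "(?P has_vector_derivative x powr (\<alpha> + s)) (at x)"
      by (simp add: has_real_derivative_iff_has_vector_derivative)
  qed fact
  have "((\<lambda>t. \<bar>t powr \<alpha> - (1 - t) powr \<alpha>\<bar> * t powr s) has_integral ?B1 - (?P (1/2) - ?P 0)) {0..1/2}"
  proof (rule has_integral_eq[OF _ has_integral_diff[OF B1 P]])
    fix t :: real assume t: "t \<in> {0..1/2}"
    then have "t powr \<alpha> \<le> (1 - t) powr \<alpha>"
      using assms by (intro powr_mono2) auto
    then show "t powr s * (1 - t) powr \<alpha> - t powr (\<alpha> + s) = \<bar>t powr \<alpha> - (1 - t) powr \<alpha>\<bar> * t powr s"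
      by (simp add: powr_add algebra_simps)
  qed auto
  moreover have "((\<lambda>t. \<bar>t powr \<alpha> - (1 - t) powr \<alpha>\<bar> * t powr s) has_integral ?P 1 - ?P (1/2) - ?B2) {1/2..1}"
  proof (rule has_integral_eq[OF _ has_integral_diff[OF P B2]])
    fix t :: real assume t: "t \<in> {1/2..1}"
    then have "(1 - t) powr \<alpha> \<le> t powr \<alpha>"
      using assms by (intro powr_mono2) auto
    then show "t powr (\<alpha> + s) - (1 - t) powr \<alpha> * t powr s = \<bar>t powr \<alpha> - (1 - t) powr \<alpha>\<bar> * t powr s"
      by (simp add: powr_add algebra_simps)
  qed auto
  ultimately have "((\<lambda>t. \<bar>t powr \<alpha> - (1 - t) powr \<alpha>\<bar> * t powr s) has_integral
      (?B1 - (?P (1/2) - ?P 0)) + (?P 1 - ?P (1/2) - ?B2)) {0..1}"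
    by (intro has_integral_combine[of 0 "1/2" 1]) auto
  moreover have "2 * ?P (1/2) = 1 / ((\<alpha> + s + 1) * 2 powr (\<alpha> + s))"
    by (simp add: powr_divide powr_add)
  then have "?P 1 - 2 * ?P (1/2) = (2 powr (\<alpha> + s) - 1) / ((\<alpha> + s + 1) * 2 powr (\<alpha> + s))"
    using assms by (simp add: diff_divide_distrib)
  then have "(?B1 - (?P (1/2) - ?P 0)) + (?P 1 - ?P (1/2) - ?B2)
      = ?B1 - ?B2 + (2 powr (\<alpha> + s) - 1) / ((\<alpha> + s + 1) * 2 powr (\<alpha> + s))"
    by simp
  ultimately show ?thesis
    by (simp only:)
qed

section \<open>The inequality for s-convex derivatives\<close>

lemma s_convex2_on_chord_bound:
  assumes "s_convex2_on s a b g" and "a < r" and "r \<le> b" and "x \<in> {a..r}"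
  shows "g x \<le> ((r - x) / (r - a)) powr s * g a + ((x - a) / (r - a)) powr s * g r"
proof -
  let ?t = "(r - x) / (r - a)"
  have t: "?t \<in> {0..1}" and t': "1 - ?t = (x - a) / (r - a)"
    using assms(2,4) by (auto simp: field_simps)
  have a: "a \<in> {a..b}" and r: "r \<in> {a..b}"
    using assms(2,3) by auto
  have "?t * (r - a) = r - x"
    using assms(2) by simp
  then have "?t * a + (1 - ?t) * r = x"
    by (simp only: algebra_simps)
  moreover have "g (?t * a + (1 - ?t) * r) \<le> ?t powr s * g a + (1 - ?t) powr s * g r"
    using assms(1-3) unfolding s_convex2_on_def by (blast intro: t a r)
  ultimately show ?thesis by (simp add: t')
qed

theorem theorem5:
  fixes a b \<alpha> s r :: real and f f' :: "real \<Rightarrow> real"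
  assumes "0 \<le> a" and "a < b"
    and "\<alpha> > 0"
    and "0 < s" and "s \<le> 1"
    and "a < r" and "r \<le> b"
    and "\<And>x. a < x \<Longrightarrow> x < b \<Longrightarrow> (f has_real_derivative f' x) (at x)"
    and "(f has_real_derivative f' a) (at_right a)"
    and "(f has_real_derivative f' b) (at_left b)"
    and "f' absolutely_integrable_on {a..b}"
    and "s_convex2_on s a b (\<lambda>x. \<bar>f' x\<bar>)"
  shows "\<bar>(f a + f r) / 2 - Gamma (\<alpha> + 1) / (2 * (r - a) powr \<alpha>) *
            (RL_left a \<alpha> f r + RL_right r \<alpha> f a)\<bar>
         \<le> (r - a) / 2 *
            (incomplete_beta (1/2) (s + 1) (\<alpha> + 1) - incomplete_beta (1/2) (\<alpha> + 1) (s + 1)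
             + (2 powr (\<alpha> + s) - 1) / ((\<alpha> + s + 1) * 2 powr (\<alpha> + s))) *
            (\<bar>f' a\<bar> + \<bar>f' r\<bar>)"
proof -
  define K where "K = incomplete_beta (1/2) (s + 1) (\<alpha> + 1) - incomplete_beta (1/2) (\<alpha> + 1) (s + 1)
             + (2 powr (\<alpha> + s) - 1) / ((\<alpha> + s + 1) * 2 powr (\<alpha> + s))"
  define w where "w x = (x - a) powr \<alpha> - (r - x) powr \<alpha>" for x
  define c where "c = (r - a) powr \<alpha>"
  have c: "c > 0" using assms(6) by (simp add: c_def)
  have "continuous (at x within {a..b}) f" if x: "x \<in> {a..b}" for x
  proof -
    consider "x = a" | "x = b" | "a < x" "x < b"
      using x by fastforce
    then show ?thesis
    proof cases
      case 1
      then show ?thesis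
        using assms(2,9)
        by (metis at_within_Icc_at_right has_field_derivative_imp_has_derivative has_derivative_continuous)
    next
      case 2
      then show ?thesis
        using assms(2,10)
        by (metis at_within_Icc_at_left has_field_derivative_imp_has_derivative has_derivative_continuous)
    next
      case 3
      then show ?thesis
        using assms(8) DERIV_isCont continuous_at_imp_continuous_at_within by blast
    qed
  qed
  then have "continuous_on {a..b} f"
    by (simp add: continuous_on_eq_continuous_within)
  then have cont: "continuous_on {a..r} f"
    using assms(7) by (rule_tac continuous_on_subset) auto
  have f': "f' absolutely_integrable_on {a..r}"
    using assms(11) by (rule absolutely_integrable_on_subinterval) (use assms in auto)
  have wf': "(\<lambda>x. w x * f' x) absolutely_integrable_on {a..r}"
    unfolding w_def using assms(3)
    by (intro absolutely_integrable_continuous_mult f' continuous_intros continuous_on_powr') auto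
  \<comment> \<open>The moment on the unit interval is carried to \<open>{a..r}\<close>, where it gives the integral for the
    weight at \<open>r\<close>; reflection about the midpoint preserves \<open>\<bar>w\<bar>\<close> and gives the one at \<open>a\<close>.\<close>
  have unit: "((\<lambda>t. \<bar>t powr \<alpha> - (1 - t) powr \<alpha>\<bar> * t powr s) has_integral K) {0..1}"
    unfolding K_def by (rule powr_difference_moment[OF assms(3,4)])
  have w_unit: "c * \<bar>((x - a) / (r - a)) powr \<alpha> - (1 - (x - a) / (r - a)) powr \<alpha>\<bar> = \<bar>w x\<bar>"
    if "x \<in> {a..r}" for x
  proof -
    have "1 - (x - a) / (r - a) = (r - x) / (r - a)"
      using assms(6) by (simp add: field_simps)
    then have "((x - a) / (r - a)) powr \<alpha> - (1 - (x - a) / (r - a)) powr \<alpha> = w x / c"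
      using that by (simp add: w_def c_def powr_divide diff_divide_distrib[of "_ powr _"])
    then show ?thesis using c by (simp add: abs_divide)
  qed
  have right: "((\<lambda>x. \<bar>w x\<bar> * ((x - a) / (r - a)) powr s) has_integral c * ((r - a) * K)) {a..r}"
    using has_integral_mult_right[OF has_integral_rescale_unit[OF unit assms(6)], of c]
    by (rule has_integral_eq[rotated]) (simp add: w_unit[symmetric])
  have left: "((\<lambda>x. \<bar>w x\<bar> * ((r - x) / (r - a)) powr s) has_integral c * ((r - a) * K)) {a..r}"
    using has_integral_reflect_interval[OF right, of "a + r"]
    by (simp add: w_def abs_minus_commute)
  have bound: "((\<lambda>x. \<bar>w x\<bar> * (((r - x) / (r - a)) powr s * \<bar>f' a\<bar> + ((x - a) / (r - a)) powr s * \<bar>f' r\<bar>))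
      has_integral c * ((r - a) * K) * \<bar>f' a\<bar> + c * ((r - a) * K) * \<bar>f' r\<bar>) {a..r}"
    using has_integral_add[OF has_integral_mult_left[OF left, of "\<bar>f' a\<bar>"]
        has_integral_mult_left[OF right, of "\<bar>f' r\<bar>"]]
    by (simp add: algebra_simps)
  have "\<bar>integral {a..r} (\<lambda>x. w x * f' x)\<bar>
      \<le> integral {a..r} (\<lambda>x. \<bar>w x\<bar> * (((r - x) / (r - a)) powr s * \<bar>f' a\<bar> + ((x - a) / (r - a)) powr s * \<bar>f' r\<bar>))"
    unfolding real_norm_def[symmetric]
  proof (rule integral_norm_bound_integral)
    show "(\<lambda>x. w x * f' x) integrable_on {a..r}"
      by (rule set_lebesgue_integral_eq_integral(1)[OF wf'])
    fix x assume "x \<in> {a..r}"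
    from s_convex2_on_chord_bound[OF assms(12,6,7) this]
    show "norm (w x * f' x) \<le> norm (w x) * (((r - x) / (r - a)) powr s * norm (f' a) + ((x - a) / (r - a)) powr s * norm (f' r))"
      by (simp add: abs_mult mult_left_mono)
  qed (use bound in \<open>auto simp: integrable_on_def\<close>)
  also have "\<dots> = c * (r - a) * K * (\<bar>f' a\<bar> + \<bar>f' r\<bar>)"
    using integral_unique[OF bound] by (simp add: algebra_simps)
  finally have main: "\<bar>integral {a..r} (\<lambda>x. w x * f' x)\<bar> \<le> c * (r - a) * K * (\<bar>f' a\<bar> + \<bar>f' r\<bar>)" .
  have "\<bar>(f a + f r) / 2 - Gamma (\<alpha> + 1) / (2 * (r - a) powr \<alpha>) *
            (RL_left a \<alpha> f r + RL_right r \<alpha> f a)\<bar> = 1 / (2 * c) * \<bar>integral {a..r} (\<lambda>x. w x * f' x)\<bar>"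
    using trapezoid_error_RL_integral[OF assms(3,6) cont _ f'] assms(7,8) c
    by (simp add: w_def c_def abs_mult)
  also have "\<dots> \<le> 1 / (2 * c) * (c * (r - a) * K * (\<bar>f' a\<bar> + \<bar>f' r\<bar>))"
    using main c by (intro mult_left_mono) auto
  also have "\<dots> = (r - a) / 2 * K * (\<bar>f' a\<bar> + \<bar>f' r\<bar>)"
    using c by simp
  finally show ?thesis
    unfolding K_def .
qed

end
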